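(* Let $n \geq 2$ and let $p(z)=\sum_{j=0}^{n} a_j z^j$ be a real polynomial with positive coefficients $a_0,\dots,a_n>0$. Define $$\mu=\left(\max_{0\leq j\leq n-2}\frac{a_j}{a_{j+2}}\right)^{1/2}\quad\text{and}\quad R=\mu^2+\frac{a_{n-1}}{a_n}\mu.$$ Then all the zeros of $p$ are included in the union of disks $$\{z\in\mathbb{C}:|z|\leq R^{1/2}\}\ \cup\ \left\{z\in\mathbb{C}:\left|z+\frac{a_{n-1}}{a_n}\right|\leq R^{1/2}\right\}.$$ If the two disks are disjoint, then the disk centered at $-a_{n-1}/a_n$ contains one zero of $p$ and the one centered at the origin contains the remaining $n-1$ zeros of $p$.
   Context: Zeros are complex zeros, counted with multiplicity. *)

theory Defs
  imports
    "HOL-Complex_Analysis.Complex_Analysis"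
    "HOL-Computational_Algebra.Computational_Algebra"
begin

end

theory Submission
  imports Defs
begin

text \<open>
  The idea is to multiply \<open>p\<close> by \<open>z\<^sup>2 - \<mu>\<^sup>2\<close>. With \<open>s = a\<^sub>n\<^sub>-\<^sub>1 / a\<^sub>n\<close>, this gives
  \<open>(z\<^sup>2 - \<mu>\<^sup>2) p(z) = a\<^sub>n z\<^sup>n\<^sup>+\<^sup>1 (z + s) - (\<Sum>j\<le>n. c\<^sub>j z\<^sup>j)\<close>, where
  \<open>c\<^sub>j = \<mu>\<^sup>2 a\<^sub>j - a\<^sub>j\<^sub>-\<^sub>2\<close> (lemma \<open>times_sq_minus_sq_eq\<close>), and \<open>\<mu>\<close> is just large enough for
  all \<open>c\<^sub>j\<close> to be nonnegative. At \<open>z = \<mu>\<close> the left-hand side vanishes, so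
  \<open>\<Sum>j\<le>n. c\<^sub>j \<mu>\<^sup>j = a\<^sub>n \<mu>\<^sup>n R\<close>. As the \<open>c\<^sub>j\<close> are nonnegative and the sum has degree at most \<open>n\<close>,
  it is bounded by \<open>a\<^sub>n R |z|\<^sup>n\<close> wherever \<open>|z| \<ge> \<mu>\<close> (lemma \<open>norm_tail_le\<close>).

  Outside both disks \<open>|z| |z + s| > R\<close>, and also \<open>|z| > \<mu>\<close> since \<open>\<mu>\<^sup>2 \<le> R\<close>. There
  \<open>a\<^sub>n z\<^sup>n\<^sup>+\<^sup>1 (z + s)\<close> strictly dominates the sum, and \<open>p\<close> has no zero.

  If the disks are disjoint, their radius is less than \<open>s / 2\<close>, so the circle \<open>|z + s| = s / 2\<close>
  avoids both of them. By Rouche's theorem (lemma \<open>Rouche_poly_ball\<close>)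
  \<open>(z\<^sup>2 - \<mu>\<^sup>2) p(z)\<close> has as many zeros inside this circle as \<open>a\<^sub>n z\<^sup>n\<^sup>+\<^sup>1 (z + s)\<close>, namely one.
  The factor \<open>z\<^sup>2 - \<mu>\<^sup>2\<close> contributes none of them, its zeros \<open>\<plusminus>\<mu>\<close> being in the disk around
  the origin. The other \<open>n - 1\<close> zeros of \<open>p\<close> must then be in that disk as well.
\<close>

section \<open>Rouche's theorem for polynomials on a disk\<close>

lemma zorder_poly_eq_order:
  fixes p :: "complex poly"
  assumes "p \<noteq> 0"
  shows "zorder (poly p) z = int (order z p)"
proof -
  obtain q where q: "p = [:-z, 1:] ^ order z p * q" "\<not> [:-z, 1:] dvd q"
    using order_decomp[OF assms] by blast
  show ?thesis
  proof (rule zorder_eqI[where S = UNIV and g = "poly q"])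
    show "poly q z \<noteq> 0"
      using q(2) by (simp add: poly_eq_0_iff_dvd)
    fix w
    have "poly p w = poly ([:-z, 1:] ^ order z p * q) w"
      using q(1) by simp
    then show "poly p w = poly q w * (w - z) powi int (order z p)"
      by (simp add: poly_power power_int_of_nat mult.commute)
  qed (auto intro!: holomorphic_intros)
qed

lemma size_filter_proots:
  fixes p :: "'a :: idom poly"
  assumes "p \<noteq> 0"
  shows "size (filter_mset Q (proots p)) = (\<Sum>z | poly p z = 0 \<and> Q z. order z p)"
proof -
  have "size (filter_mset Q (proots p)) =
        (\<Sum>z | z \<in># proots p \<and> Q z. count (filter_mset Q (proots p)) z)"
    by (simp add: size_multiset_overloaded_eq)
  also have "\<dots> = (\<Sum>z | poly p z = 0 \<and> Q z. order z p)"
    using assms by (intro sum.cong) auto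
  finally show ?thesis .
qed

text \<open>
  Around a circle the winding number is the indicator function of the open disk (at points off the
  circle), and the order of a polynomial as a holomorphic function is its algebraic order. So both
  sides of the general Rouche theorem count roots with multiplicity in the disk.
\<close>

lemma Rouche_poly_ball:
  fixes f g :: "complex poly"
  assumes less: "\<And>z. z \<in> sphere c r \<Longrightarrow> norm (poly g z) < norm (poly f z)" and "r > 0"
  shows "size (filter_mset (\<lambda>z. z \<in> ball c r) (proots (f + g))) =
         size (filter_mset (\<lambda>z. z \<in> ball c r) (proots f))"
proof -
  have *: "(\<Sum>z | poly h z = 0. winding_number (circlepath c r) z * zorder (poly h) z) =
           of_nat (size (filter_mset (\<lambda>z. z \<in> ball c r) (proots h)))"
    if nz: "\<forall>z\<in>sphere c r. poly h z \<noteq> 0" for h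
  proof -
    have "c + of_real r \<in> sphere c r"
      using \<open>r > 0\<close> by (simp add: dist_norm)
    with nz have "h \<noteq> 0" by force
    have "(\<Sum>z | poly h z = 0. winding_number (circlepath c r) z * zorder (poly h) z) =
          (\<Sum>z | poly h z = 0. if z \<in> ball c r then of_nat (order z h) else 0)"
    proof (intro sum.cong refl)
      fix z assume "z \<in> {z. poly h z = 0}"
      with nz have "z \<notin> sphere c r" by blast
      moreover have "winding_number (circlepath c r) z = 1" if "z \<in> ball c r"
        using that by (intro winding_number_circlepath) (simp add: dist_norm norm_minus_commute)
      moreover have "winding_number (circlepath c r) z = 0" if "z \<notin> cball c r"
        using that \<open>r > 0\<close> by (intro winding_number_zero_outside[of _ "cball c r"]) auto
      ultimately show "winding_number (circlepath c r) z * zorder (poly h) z =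
                       (if z \<in> ball c r then of_nat (order z h) else 0)"
        by (auto simp: zorder_poly_eq_order[OF \<open>h \<noteq> 0\<close>])
    qed
    also have "\<dots> = (\<Sum>z | poly h z = 0 \<and> z \<in> ball c r. of_nat (order z h))"
      using poly_roots_finite[OF \<open>h \<noteq> 0\<close>]
      by (simp add: sum.inter_filter[symmetric] Collect_conj_eq[symmetric])
    finally show ?thesis
      by (simp add: size_filter_proots[OF \<open>h \<noteq> 0\<close>])
  qed
  have nzf: "\<forall>z\<in>sphere c r. poly f z \<noteq> 0" and nzfg: "\<forall>z\<in>sphere c r. poly (f + g) z \<noteq> 0"
    using less by (fastforce simp: add_eq_0_iff)+
  have "c + of_real r \<in> sphere c r"
    using \<open>r > 0\<close> by (simp add: dist_norm)
  with nzf nzfg have "f \<noteq> 0" "f + g \<noteq> 0" by force+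
  have "(\<Sum>z | poly (f + g) z = 0. winding_number (circlepath c r) z * zorder (poly (f + g)) z) =
        (\<Sum>z | poly f z = 0. winding_number (circlepath c r) z * zorder (poly f) z)"
    using Rouche_theorem[of UNIV "poly f" "poly g" "circlepath c r"]
      poly_roots_finite[OF \<open>f \<noteq> 0\<close>] poly_roots_finite[OF \<open>f + g \<noteq> 0\<close>] less \<open>r > 0\<close>
    by (simp add: poly_add[abs_def] holomorphic_intros connected_UNIV)
  then have "(of_nat (size (filter_mset (\<lambda>z. z \<in> ball c r) (proots (f + g)))) :: complex) =
             of_nat (size (filter_mset (\<lambda>z. z \<in> ball c r) (proots f)))"
    unfolding *[OF nzf] *[OF nzfg] .
  then show ?thesis
    by (simp only: of_nat_eq_iff)
qed

section \<open>Multiplication by \<open>z\<^sup>2 - \<mu>\<^sup>2\<close>\<close>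

text \<open>
  Up to sign, the coefficient of \<open>x\<^sup>j\<close> with \<open>j \<le> n\<close> in \<open>(x\<^sup>2 - \<mu>\<^sup>2) (\<Sum>j\<le>n. a\<^sub>j x\<^sup>j)\<close>. The case distinction
  encodes \<open>a\<^sub>-\<^sub>1 = a\<^sub>-\<^sub>2 = 0\<close>, which truncated subtraction would turn into \<open>a\<^sub>0\<close>.
\<close>

definition tail_coeff :: "(nat \<Rightarrow> real) \<Rightarrow> real \<Rightarrow> nat \<Rightarrow> real" where
  "tail_coeff a \<mu> j = \<mu>\<^sup>2 * a j - (if j < 2 then 0 else a (j - 2))"

text \<open>
  Stated over any real normed field, since the identity serves twice: for complex \<open>x\<close>, and at the
  real point \<open>x = \<mu>\<close> in order to evaluate the sum on the right.
\<close>

lemma times_sq_minus_sq_eq: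
  fixes x :: "'a :: real_normed_field"
  assumes "n \<ge> 2"
  shows "(x\<^sup>2 - of_real (\<mu>\<^sup>2)) * (\<Sum>j\<le>n. of_real (a j) * x ^ j) =
         of_real (a n) * x ^ (n + 2) + of_real (a (n - 1)) * x ^ (n + 1)
         - (\<Sum>j\<le>n. of_real (tail_coeff a \<mu> j) * x ^ j)"
proof -
  obtain m where n: "n = Suc (Suc m)"
    using assms by (metis add_2_eq_Suc le_Suc_ex)
  define S where "S = (\<Sum>j\<le>m. of_real (a j) * x ^ j)"
  have shift: "(\<Sum>j\<le>n. of_real (if j < 2 then 0 else a (j - 2)) * x ^ j) = x\<^sup>2 * S"
    unfolding n S_def sum.atMost_Suc_shift
    by (simp add: sum_distrib_left power2_eq_square mult_ac)
  have tail: "(\<Sum>j\<le>n. of_real (tail_coeff a \<mu> j) * x ^ j) =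
        of_real (\<mu>\<^sup>2) * (\<Sum>j\<le>n. of_real (a j) * x ^ j) - x\<^sup>2 * S"
    unfolding shift[symmetric] tail_coeff_def
    by (simp add: sum_distrib_left sum_subtractf algebra_simps)
  have "(\<Sum>j\<le>n. of_real (a j) * x ^ j) =
        S + of_real (a (n - 1)) * x ^ (n - 1) + of_real (a n) * x ^ n"
    by (simp add: n S_def)
  then show ?thesis
    unfolding tail by (simp add: n algebra_simps power2_eq_square)
qed

text \<open>
  A polynomial of degree at most \<open>n\<close> with nonnegative coefficients grows from \<open>\<mu>\<close> to \<open>|z|\<close> by a
  factor of at most \<open>(|z| / \<mu>)\<^sup>n\<close>, and its value at \<open>\<mu>\<close> is known because \<open>x\<^sup>2 - \<mu>\<^sup>2\<close> vanishes there.
\<close>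

lemma norm_tail_le:
  fixes z :: complex
  assumes n: "n \<ge> 2" and "\<mu> > 0" and "\<mu> \<le> norm z" and an: "a n > 0"
    and nonneg: "\<And>j. j \<le> n \<Longrightarrow> tail_coeff a \<mu> j \<ge> 0"
  shows "norm (\<Sum>j\<le>n. of_real (tail_coeff a \<mu> j) * z ^ j) \<le>
         a n * (\<mu>\<^sup>2 + a (n - 1) / a n * \<mu>) * norm z ^ n"
proof -
  have "norm (\<Sum>j\<le>n. of_real (tail_coeff a \<mu> j) * z ^ j) \<le>
        (\<Sum>j\<le>n. tail_coeff a \<mu> j * norm z ^ j)"
    using nonneg by (intro sum_norm_le) (simp add: norm_mult norm_power)
  also have "\<dots> \<le> (\<Sum>j\<le>n. tail_coeff a \<mu> j * \<mu> ^ j * (norm z / \<mu>) ^ n)"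
  proof (rule sum_mono)
    fix j assume "j \<in> {..n}"
    have "norm z ^ j = \<mu> ^ j * (norm z / \<mu>) ^ j"
      using \<open>\<mu> > 0\<close> by (simp add: power_divide)
    also have "\<dots> \<le> \<mu> ^ j * (norm z / \<mu>) ^ n"
      using assms(2,3) \<open>j \<in> {..n}\<close> by (intro mult_left_mono power_increasing) auto
    finally show "tail_coeff a \<mu> j * norm z ^ j \<le> tail_coeff a \<mu> j * \<mu> ^ j * (norm z / \<mu>) ^ n"
      using nonneg[of j] \<open>j \<in> {..n}\<close> by (simp add: mult.assoc mult_left_mono)
  qed
  also have "\<dots> = (\<Sum>j\<le>n. tail_coeff a \<mu> j * \<mu> ^ j) * (norm z / \<mu>) ^ n"
    by (simp add: sum_distrib_right)
  also have "(\<Sum>j\<le>n. tail_coeff a \<mu> j * \<mu> ^ j) = a n * \<mu> ^ (n + 2) + a (n - 1) * \<mu> ^ (n + 1)"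
    using times_sq_minus_sq_eq[OF n, of \<mu> \<mu> a] by simp
  also have "(a n * \<mu> ^ (n + 2) + a (n - 1) * \<mu> ^ (n + 1)) * (norm z / \<mu>) ^ n =
             a n * (\<mu>\<^sup>2 + a (n - 1) / a n * \<mu>) * norm z ^ n"
    using \<open>\<mu> > 0\<close> an by (simp add: power_add power_divide field_simps power2_eq_square)
  finally show ?thesis .
qed

section \<open>Location of the zeros\<close>

theorem theorem5p1:
  fixes n :: nat and a :: "nat \<Rightarrow> real" and p :: "real poly"
    and P :: "complex poly" and \<mu> R :: real and D\<^sub>0 D\<^sub>1 :: "complex set"
  assumes n: "n \<ge> 2"
    and pos: "\<And>j. j \<le> n \<Longrightarrow> a j > 0"
    and p: "p = (\<Sum>j = 0..n. monom (a j) j)"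
    and P: "P = map_poly complex_of_real p"
    and \<mu>: "\<mu> = sqrt (Max ((\<lambda>j. a j / a (j + 2)) ` {0..n - 2}))"
    and R: "R = \<mu>\<^sup>2 + a (n - 1) / a n * \<mu>"
    and D\<^sub>0: "D\<^sub>0 = {z. norm z \<le> sqrt R}"
    and D\<^sub>1: "D\<^sub>1 = {z. norm (z + complex_of_real (a (n - 1) / a n)) \<le> sqrt R}"
  shows "{z. poly P z = 0} \<subseteq> D\<^sub>0 \<union> D\<^sub>1 \<and>
    (D\<^sub>0 \<inter> D\<^sub>1 = {} \<longrightarrow>
      size (filter_mset (\<lambda>z. z \<in> D\<^sub>1) (proots P)) = 1 \<and>
      size (filter_mset (\<lambda>z. z \<in> D\<^sub>0) (proots P)) = n - 1)"
proof -
  define s where "s = a (n - 1) / a n"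
  have "a n > 0" and "s > 0"
    using pos n by (auto simp: s_def)
  let ?A = "(\<lambda>j. a j / a (j + 2)) ` {0..n - 2}"
  have "Max ?A \<ge> a 0 / a 2"
    using n by (intro Max_ge) (auto simp: numeral_2_eq_2 intro: rev_image_eqI[of 0])
  moreover have "a 0 / a 2 > 0"
    using pos n by simp
  ultimately have "Max ?A > 0"
    by linarith
  then have "\<mu> > 0" and \<mu>2: "\<mu>\<^sup>2 = Max ?A"
    by (simp_all add: \<mu>)
  have D\<^sub>1s: "D\<^sub>1 = {z. norm (z + of_real s) \<le> sqrt R}"
    by (simp only: D\<^sub>1 s_def)
  have Rs: "R = \<mu>\<^sup>2 + s * \<mu>"
    by (simp add: R s_def)
  with \<open>\<mu> > 0\<close> \<open>s > 0\<close> have "\<mu>\<^sup>2 \<le> R"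
    by simp
  then have "\<mu> \<le> sqrt R"
    by (rule real_le_rsqrt)
  with \<open>\<mu> > 0\<close> have "R > 0"
    by (smt (verit) real_sqrt_gt_0_iff)

  have nonneg: "tail_coeff a \<mu> j \<ge> 0" if "j \<le> n" for j
  proof (cases "j < 2")
    case False
    then have "j - 2 + 2 = j" by simp
    then have "a (j - 2) / a j \<in> ?A"
      using that by (intro image_eqI[of _ _ "j - 2"]) auto
    then have "a (j - 2) / a j \<le> \<mu>\<^sup>2"
      unfolding \<mu>2 by (intro Max_ge) auto
    then show ?thesis
      using False pos[OF that] by (simp add: tail_coeff_def field_simps)
  qed (use pos[OF that] in \<open>simp add: tail_coeff_def\<close>)

  define f g :: "complex poly" where "f = smult (of_real (a n)) ([:0, 1:] ^ (n + 1) * [:of_real s, 1:])"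
    and "g = - (\<Sum>j\<le>n. monom (complex_of_real (tail_coeff a \<mu> j)) j)"
  have poly_f: "poly f z = of_real (a n) * z ^ (n + 1) * (z + of_real s)" for z
    by (simp add: f_def poly_power algebra_simps)
  have coeff_p: "coeff p j = (if j \<le> n then a j else 0)" for j
    by (simp add: p coeff_sum)
  have "P = (\<Sum>j\<le>n. monom (complex_of_real (a j)) j)"
    by (rule poly_eqI) (simp add: P coeff_map_poly coeff_p coeff_sum)
  then have poly_P: "poly P z = (\<Sum>j\<le>n. of_real (a j) * z ^ j)" for z
    by (simp add: poly_sum poly_monom)
  have fg: "[:- of_real (\<mu>\<^sup>2), 0, 1:] * P = f + g"
  proof (rule poly_ext)
    fix z
    have "poly ([:- of_real (\<mu>\<^sup>2), 0, 1:] * P) z =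
          (z\<^sup>2 - of_real (\<mu>\<^sup>2)) * (\<Sum>j\<le>n. of_real (a j) * z ^ j)"
      by (simp add: poly_P power2_eq_square left_diff_distrib mult.assoc)
    also have "\<dots> = poly (f + g) z"
      unfolding times_sq_minus_sq_eq[OF n]
      using \<open>a n > 0\<close> by (simp add: poly_f g_def poly_sum poly_monom s_def field_simps)
    finally show "poly ([:- of_real (\<mu>\<^sup>2), 0, 1:] * P) z = poly (f + g) z" .
  qed
  have norm_f: "norm (poly f z) = a n * norm z ^ n * (norm z * norm (z + of_real s))" for z
    using \<open>a n > 0\<close> by (simp add: poly_f norm_mult norm_power)
  have norm_g: "norm (poly g z) \<le> a n * norm z ^ n * R" if "\<mu> \<le> norm z" for z
    using norm_tail_le[OF n \<open>\<mu> > 0\<close> that \<open>a n > 0\<close> nonneg]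
    by (simp add: g_def poly_sum poly_monom R mult_ac)

  have dominates: "norm (poly g z) < norm (poly f z)"
    if z: "sqrt R < norm z" "sqrt R < norm (z + of_real s)" for z
  proof -
    have "\<mu> \<le> norm z" and "norm z > 0"
      using z \<open>\<mu> \<le> sqrt R\<close> \<open>\<mu> > 0\<close> by linarith+
    have "R < norm z * norm (z + of_real s)"
      using mult_strict_mono'[OF z] \<open>R > 0\<close> by simp
    then have "a n * norm z ^ n * R < norm (poly f z)"
      unfolding norm_f using \<open>a n > 0\<close> \<open>norm z > 0\<close> by (intro mult_strict_left_mono) auto
    with norm_g[OF \<open>\<mu> \<le> norm z\<close>] show ?thesis
      by linarith
  qed

  have roots: "z \<in> D\<^sub>0 \<union> D\<^sub>1" if "poly P z = 0" for z
  proof (rule ccontr)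
    assume "z \<notin> D\<^sub>0 \<union> D\<^sub>1"
    then have "norm (poly g z) < norm (poly f z)"
      by (intro dominates) (auto simp: D\<^sub>0 D\<^sub>1s)
    moreover have "poly f z = - poly g z"
      using that by (simp add: fg[symmetric] eq_neg_iff_add_eq_0 flip: poly_add)
    ultimately show False by simp
  qed

  have "size (filter_mset (\<lambda>z. z \<in> D\<^sub>1) (proots P)) = 1 \<and>
        size (filter_mset (\<lambda>z. z \<in> D\<^sub>0) (proots P)) = n - 1" if disj: "D\<^sub>0 \<inter> D\<^sub>1 = {}"
  proof -
    have "degree p = n"
      using \<open>a n > 0\<close> by (intro antisym degree_le le_degree) (auto simp: coeff_p)
    then have "degree P = n"
      by (simp add: P degree_map_poly)
    with n have "P \<noteq> 0" by auto
    \<comment> \<open>The midpoint of the two centers would lie in both disks if their radius were at least \<open>s / 2\<close>.\<close>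
    have "- of_real (s / 2) \<notin> D\<^sub>0 \<inter> D\<^sub>1"
      using disj by simp
    moreover have "norm (- complex_of_real (s / 2)) = s / 2"
      using \<open>s > 0\<close> by (simp add: norm_divide)
    moreover have "- complex_of_real (s / 2) + of_real s = of_real (s / 2)"
      by (simp add: field_simps)
    ultimately have sR: "sqrt R < s / 2"
      using \<open>s > 0\<close> by (simp only: D\<^sub>0 D\<^sub>1s Int_iff mem_Collect_eq norm_of_real) auto
    define B where "B = ball (- complex_of_real s) (s / 2)"
    have dist_center: "dist (- of_real s) z = norm (z + of_real s)" for z :: complex
      by (subst dist_commute) (simp add: dist_norm)
    have B: "z \<in> B \<longleftrightarrow> norm (z + of_real s) < s / 2" for z
      by (simp add: B_def dist_center)
    have far: "s \<le> norm z + norm (z + of_real s)" for z :: complex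
      using norm_triangle_ineq4[of "z + of_real s" z] \<open>s > 0\<close> by simp
    have "size (filter_mset (\<lambda>z. z \<in> B) (proots (f + g))) = size (filter_mset (\<lambda>z. z \<in> B) (proots f))"
      unfolding B_def
    proof (rule Rouche_poly_ball)
      fix z assume "z \<in> sphere (- complex_of_real s) (s / 2)"
      then have eq: "norm (z + of_real s) = s / 2"
        by (simp add: dist_center)
      then show "norm (poly g z) < norm (poly f z)"
        using far[of z] sR by (intro dominates) linarith+
    qed (use \<open>s > 0\<close> in simp)
    also have "proots f = repeat_mset (n + 1) {#0#} + {#- of_real s#}"
    proof -
      have "proots f = proots ([:0, 1:] ^ (n + 1) * [:of_real s, 1:])"
        using \<open>a n > 0\<close> unfolding f_def by (subst proots_smult) auto
      also have "\<dots> = repeat_mset (n + 1) (proots [:0, 1:]) + {#- of_real s#}"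
        by (subst proots_mult) (auto simp: proots_power simp del: power_Suc)
      finally show ?thesis
        by simp
    qed
    also have "size (filter_mset (\<lambda>z. z \<in> B) \<dots>) = 1"
      using \<open>s > 0\<close> by (simp add: B)
    also have "proots (f + g) = proots [:- of_real (\<mu>\<^sup>2), 0, 1:] + proots P"
      unfolding fg[symmetric] using \<open>P \<noteq> 0\<close> by (subst proots_mult) auto
    also have "filter_mset (\<lambda>z. z \<in> B) \<dots> = filter_mset (\<lambda>z. z \<in> B) (proots P)"
    proof -
      have "z \<notin> B" if "poly [:- complex_of_real (\<mu>\<^sup>2), 0, 1:] z = 0" for z
      proof -
        have "z\<^sup>2 = of_real (\<mu>\<^sup>2)"
          using that by (simp add: power2_eq_square add_eq_0_iff)
        then have "norm z ^ 2 = \<mu>\<^sup>2"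
          by (metis norm_of_real norm_power abs_power2)
        then have "norm z = \<mu>"
          using \<open>\<mu> > 0\<close> by (simp add: power2_eq_iff_nonneg)
        then show ?thesis
          using far[of z] sR \<open>\<mu> \<le> sqrt R\<close> by (simp add: B)
      qed
      then have "filter_mset (\<lambda>z. z \<in> B) (proots [:- complex_of_real (\<mu>\<^sup>2), 0, 1:]) = {#}"
        by simp
      then show ?thesis
        by simp
    qed
    also have "\<dots> = filter_mset (\<lambda>z. z \<in> D\<^sub>1) (proots P)"
    proof (rule filter_mset_cong[OF refl])
      fix z assume "z \<in># proots P"
      with \<open>P \<noteq> 0\<close> roots have "z \<in> D\<^sub>0 \<union> D\<^sub>1" by simp
      then show "z \<in> B \<longleftrightarrow> z \<in> D\<^sub>1"
        using far[of z] sR by (auto simp: B D\<^sub>0 D\<^sub>1s)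
    qed
    finally have one: "size (filter_mset (\<lambda>z. z \<in> D\<^sub>1) (proots P)) = 1" .
    have "filter_mset (\<lambda>z. z \<in> D\<^sub>0) (proots P) = filter_mset (\<lambda>z. z \<notin> D\<^sub>1) (proots P)"
      using \<open>P \<noteq> 0\<close> roots disj by (intro filter_mset_cong) auto
    moreover have "size (filter_mset (\<lambda>z. z \<in> D\<^sub>1) (proots P)) +
                   size (filter_mset (\<lambda>z. z \<notin> D\<^sub>1) (proots P)) = n"
      using multiset_partition[of "proots P" "\<lambda>z. z \<in> D\<^sub>1"] size_proots_complex[of P] \<open>degree P = n\<close>
      by (metis size_union)
    ultimately show ?thesis
      using one by simp
  qed
  with roots show ?thesis by blast
qed

end
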